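(* Let $A\in M_q(\mathbb C)$ and let $$\pmb A=N(A)+\mathcal A_0\Lambda_0+\cdots+\mathcal A_m\Lambda_m$$ be the $\mathcal P$-canonical form of $A$ relative to $(\mathcal S^{\ast},\mathcal T)$. Then for every $t\in\mathbb C$, the $\mathcal P$-canonical form relative to $(\mathcal S^{\ast},\mathcal H)$ of $\mathrm e^{tA}$ is obtained from the $\mathcal P$-canonical form $\pmb A=N(A)+\mathcal A_0\Lambda_0+\cdots+\mathcal A_m\Lambda_m$ of $A$ relative to $(\mathcal S^{\ast},\mathcal T)$ by the substitutions $$\pmb\lambda\Lambda_i\hookrightarrow\frac{(t\lambda)^i\,\pmb{\mathrm e^{t\lambda}}\,\Gamma^i}{i!},\qquad \pmb 0_i\hookrightarrow\frac{t^i\Gamma^i}{i!}.$$ Explicitly: if $N(A)=\sum_i\mathcal V_i\pmb 0_i$ and $\mathcal A_i=\sum_{\lambda}A_{i,\lambda}\pmb\lambda$ with $\mathcal V_i,A_{i,\lambda}\in M_q(\mathbb C)$ (finite sums over nonzero $\lambda\in\mathbb C$), then the $\mathcal P$-canonical form of $\mathrm e^{tA}$ relative to $(\mathcal S^{\ast},\mathcal H)$ is $$\pmb{\mathrm e^{tA}}=\sum_i\mathcal V_i\,\frac{t^i\Gamma^i}{i!}+\sum_{i=0}^m\sum_\lambda A_{i,\lambda}\,\frac{(t\lambda)^i\,\pmb{\mathrm e^{t\lambda}}\,\Gamma^i}{i!}$$ (after collecting, for each $i$, the coefficient of $\Gamma^i$).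
   Context: All sequences are indexed by $k\ge0$ and multiplied termwise; $0^0=1$. For a square complex matrix $M$, $\pmb M=(M^k)_{k\ge0}$. For $\lambda\in\mathbb C\setminus\{0\}$, $\pmb\lambda=(\lambda^k)_{k\ge0}$; $\pmb 0_n=(\delta_{n,k})_{k\ge0}$ (Kronecker symbol); $\Lambda_i=(\binom ki)_{k\ge0}$; $\Gamma=(0,1,2,\dots)$, so $\Gamma^i=(k^i)_{k\ge0}$ and $\Gamma^0=(1,1,\dots)$. $\mathcal S^{\ast}=\{\pmb\lambda:\lambda\in\mathbb C,\lambda\ne0\}$, $\mathbb C_{\mathcal S^{\ast}}$ is its complex linear span, $\mathcal T=\{\Lambda_n:n\in\mathbb N\}$, $\mathcal H=(\Gamma^n)_{n\ge0}$. For every square complex matrix $M$ there are uniquely determined matrices $\mathcal V_0,\dots,\mathcal V_n$ with complex entries and matrices $\mathcal A_0,\dots,\mathcal A_l$, respectively $\mathcal A'_0,\dots,\mathcal A'_l$, with entries in $\mathbb C_{\mathcal S^{\ast}}$ such that $$\pmb M=N(M)+\mathcal A_0\Lambda_0+\cdots+\mathcal A_l\Lambda_l,\qquad \pmb M=N(M)+\mathcal A'_0\Gamma^0+\cdots+\mathcal A'_l\Gamma^l,$$ where $N(M)=\mathcal V_0\pmb 0_0+\cdots+\mathcal V_n\pmb 0_n$ (uniqueness up to zero terms). The first is the $\mathcal P$-canonical form of $M$ relative to $(\mathcal S^{\ast},\mathcal T)$, the second the $\mathcal P$-canonical form of $M$ relative to $(\mathcal S^{\ast},\mathcal H)$. 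*)

theory Defs
  imports
    "HOL-Analysis.Analysis"
    "HOL-Library.Function_Algebras"
    "HOL-Computational_Algebra.Polynomial"
begin

subsection \<open>Matrices\<close>

text \<open>
  The class operations \<open>*\<close>, \<open>^\<close> and \<open>1\<close> on \<^typ>\<open>complex^'q^'q\<close> are entrywise
  (Hadamard), so the powers and the exponential of a matrix are built from \<open>**\<close>.
\<close>

definition mat_scale :: "complex \<Rightarrow> complex^'n^'m \<Rightarrow> complex^'n^'m"  (infixr \<open>*\<^sub>m\<close> 75)
  where "c *\<^sub>m M = (\<chi> i j. c * M $ i $ j)"

definition mat_power :: "complex^'q^'q \<Rightarrow> nat \<Rightarrow> complex^'q^'q"
  where "mat_power M k = ((\<lambda>X. M ** X) ^^ k) (mat 1)"

definition mat_exp :: "complex^'q^'q \<Rightarrow> complex^'q^'q"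
  where "mat_exp M = (\<Sum>k. (1 / fact k) *\<^sub>R mat_power M k)"


subsection \<open>Sequences\<close>

text \<open>
  Complex sequences carry the pointwise ring structure of \<^theory>\<open>HOL-Library.Function_Algebras\<close>,
  so that \<open>Gamma_seq ^ i\<close> below is the termwise power \<open>(k\<^sup>i)\<^sub>k\<close>, with \<open>0\<^sup>0 = 1\<close>.
\<close>

definition geom_seq :: "complex \<Rightarrow> nat \<Rightarrow> complex"
  where "geom_seq \<mu> = (\<lambda>k. \<mu> ^ k)"

definition zero_seq :: "nat \<Rightarrow> nat \<Rightarrow> complex"
  where "zero_seq n = (\<lambda>k. if n = k then 1 else 0)"

definition Lambda_seq :: "nat \<Rightarrow> nat \<Rightarrow> complex"
  where "Lambda_seq i = (\<lambda>k. of_nat (k choose i))"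

definition Gamma_seq :: "nat \<Rightarrow> complex"
  where "Gamma_seq = (\<lambda>k. of_nat k)"

definition seq_scale :: "complex \<Rightarrow> (nat \<Rightarrow> complex) \<Rightarrow> nat \<Rightarrow> complex"
  where "seq_scale c s = (\<lambda>k. c * s k)"

interpretation seq: vector_space seq_scale
  by standard (auto simp: seq_scale_def fun_eq_iff algebra_simps)

definition Sstar :: "(nat \<Rightarrow> complex) set"
  where "Sstar = {geom_seq \<mu> |\<mu>. \<mu> \<noteq> 0}"

definition C_Sstar :: "(nat \<Rightarrow> complex) set"
  where "C_Sstar = seq.span Sstar"


subsection \<open>Canonical forms\<close>

text \<open>
  \<open>P_canonical_form B M n V l \<A>\<close> says that the sequence of powers of \<open>M\<close> equals
  \<open>V 0 zero_seq 0 + \<dots> + V n zero_seq n + \<A> 0 B 0 + \<dots> + \<A> l B l\<close>, and that this is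
  the canonical form of \<open>M\<close> relative to \<open>S\<^sup>*\<close> and the family \<open>B\<close>. A matrix \<open>\<A> i\<close> with entries
  in \<^const>\<open>C_Sstar\<close> is represented as a sequence of complex matrices: its \<open>(r,c)\<close> entry is the
  sequence \<open>\<lambda>k. \<A> i k $ r $ c\<close>. Only \<open>V i\<close> for \<open>i \<le> n\<close> and \<open>\<A> i\<close> for \<open>i \<le> l\<close> matter.
  That these are determined up to zero terms is shown in \<open>P_canonical_form_T_unique\<close> and
  \<open>P_canonical_form_H_unique\<close>.
\<close>

definition P_canonical_form ::
    "(nat \<Rightarrow> nat \<Rightarrow> complex) \<Rightarrow> complex^'q^'q \<Rightarrow>
     nat \<Rightarrow> (nat \<Rightarrow> complex^'q^'q) \<Rightarrow> nat \<Rightarrow> (nat \<Rightarrow> nat \<Rightarrow> complex^'q^'q) \<Rightarrow> bool"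
  where "P_canonical_form B M n V l \<A> \<longleftrightarrow>
    (\<forall>i\<le>l. \<forall>r c. (\<lambda>k. \<A> i k $ r $ c) \<in> C_Sstar) \<and>
    (\<forall>k. mat_power M k = (\<Sum>i\<le>n. zero_seq i k *\<^sub>m V i) + (\<Sum>i\<le>l. B i k *\<^sub>m \<A> i k))"

definition P_canonical_form_T ::
    "complex^'q^'q \<Rightarrow> nat \<Rightarrow> (nat \<Rightarrow> complex^'q^'q) \<Rightarrow> nat \<Rightarrow> (nat \<Rightarrow> nat \<Rightarrow> complex^'q^'q) \<Rightarrow> bool"
  where "P_canonical_form_T = P_canonical_form Lambda_seq"

definition P_canonical_form_H ::
    "complex^'q^'q \<Rightarrow> nat \<Rightarrow> (nat \<Rightarrow> complex^'q^'q) \<Rightarrow> nat \<Rightarrow> (nat \<Rightarrow> nat \<Rightarrow> complex^'q^'q) \<Rightarrow> bool"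
  where "P_canonical_form_H = P_canonical_form (\<lambda>i. Gamma_seq ^ i)"


subsection \<open>Uniqueness of the canonical forms\<close>

lemma exp_poly_eq_0:
  fixes S :: "complex set" and p :: "complex \<Rightarrow> complex poly"
  assumes "finite S" "0 \<notin> S"
    and "\<And>k. k \<ge> N \<Longrightarrow> (\<Sum>\<mu>\<in>S. poly (p \<mu>) (of_nat k) * \<mu> ^ k) = 0"
  shows "\<forall>\<mu>\<in>S. p \<mu> = 0"
  using assms
proof (induction S arbitrary: p rule: finite_induct)
  case empty
  then show ?case by simp
next
  case (insert \<nu> T)
  have \<nu>0: "\<nu> \<noteq> 0" and T0: "0 \<notin> T" using insert.prems(1) by auto
  have "\<forall>\<mu>\<in>insert \<nu> T. p \<mu> = 0"
    if "p \<nu> = 0 \<or> degree (p \<nu>) < d"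
      "\<And>k. k \<ge> N \<Longrightarrow> (\<Sum>\<mu>\<in>insert \<nu> T. poly (p \<mu>) (of_nat k) * \<mu> ^ k) = 0" for d p
    using that
  proof (induction d arbitrary: p)
    case 0
    then have "p \<nu> = 0" by simp
    moreover have "\<forall>\<mu>\<in>T. p \<mu> = 0"
      using 0(2) insert.hyps \<open>p \<nu> = 0\<close> by (intro insert.IH[OF T0]) auto
    ultimately show ?case by simp
  next
    case (Suc d)
    define q where "q \<mu> = smult \<mu> (pcompose (p \<mu>) [:1, 1:]) - smult \<nu> (p \<mu>)" for \<mu>
    have deg: "degree (pcompose (p \<mu>) [:1, 1:]) = degree (p \<mu>)" for \<mu>
      by (simp add: degree_pcompose)
    have lc: "lead_coeff (pcompose (p \<mu>) [:1, 1:]) = lead_coeff (p \<mu>)" for \<mu>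
      by (subst lead_coeff_comp) auto
    have "\<forall>\<mu>\<in>insert \<nu> T. q \<mu> = 0"
    proof (rule Suc.IH)
      have 1: "degree (q \<nu>) \<le> degree (p \<nu>)"
        unfolding q_def by (rule degree_diff_le) (auto simp: deg)
      have 2: "coeff (q \<nu>) (degree (p \<nu>)) = 0"
        using lc[of \<nu>] unfolding q_def deg by simp
      show "q \<nu> = 0 \<or> degree (q \<nu>) < d"
      proof (cases "p \<nu> = 0 \<or> q \<nu> = 0")
        case True
        then show ?thesis by (auto simp: q_def)
      next
        case False
        have "degree (q \<nu>) \<noteq> degree (p \<nu>)"
        proof
          assume "degree (q \<nu>) = degree (p \<nu>)"
          then have "lead_coeff (q \<nu>) = 0" using 2 by simp
          then show False using False by simp
        qed
        then show ?thesis using 1 Suc.prems(1) False by simp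
      qed
    next
      fix k assume k: "N \<le> k"
      have "(\<Sum>\<mu>\<in>insert \<nu> T. poly (q \<mu>) (of_nat k) * \<mu> ^ k)
          = (\<Sum>\<mu>\<in>insert \<nu> T. poly (p \<mu>) (of_nat (Suc k)) * \<mu> ^ Suc k)
            - \<nu> * (\<Sum>\<mu>\<in>insert \<nu> T. poly (p \<mu>) (of_nat k) * \<mu> ^ k)"
        unfolding sum_distrib_left sum_subtractf[symmetric]
        by (intro sum.cong refl) (simp add: q_def poly_pcompose algebra_simps)
      also have "\<dots> = 0"
        using Suc.prems(2)[of k] Suc.prems(2)[of "Suc k"] k by simp
      finally show "(\<Sum>\<mu>\<in>insert \<nu> T. poly (q \<mu>) (of_nat k) * \<mu> ^ k) = 0" .
    qed
    then have q0: "q \<mu> = 0" if "\<mu> \<in> insert \<nu> T" for \<mu> using that by blast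
    have pT: "p \<mu> = 0" if "\<mu> \<in> T" for \<mu>
    proof -
      have "coeff (q \<mu>) (degree (p \<mu>)) = (\<mu> - \<nu>) * lead_coeff (p \<mu>)"
        using lc[of \<mu>] unfolding q_def deg by (simp add: algebra_simps)
      moreover have "\<mu> \<noteq> \<nu>" using that insert.hyps by auto
      ultimately show ?thesis using q0[of \<mu>] that by simp
    qed
    have "poly (p \<nu>) (of_nat k) = 0" if "k \<ge> N" for k
      using Suc.prems(2)[OF that] insert.hyps pT \<nu>0 by simp
    then have "of_nat ` {N..} \<subseteq> {x. poly (p \<nu>) x = 0}" by auto
    moreover have "infinite (of_nat ` {N..} :: complex set)"
      by (subst finite_image_iff) (auto simp: inj_on_def infinite_Ici)
    ultimately have "p \<nu> = 0" using poly_roots_finite finite_subset by blast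
    then show ?case using pT by simp
  qed
  from this[of p "Suc (degree (p \<nu>))"] insert.prems show ?case by simp
qed

lemma graded_poly_independent:
  fixes b :: "nat \<Rightarrow> complex poly"
  assumes "\<And>i. degree (b i) = i" "\<And>i. b i \<noteq> 0" "(\<Sum>i\<le>l. smult (c i) (b i)) = 0"
  shows "\<forall>i\<le>l. c i = 0"
  using assms(3)
proof (induction l)
  case 0
  then show ?case using assms(2)[of 0] by simp
next
  case (Suc l)
  have "coeff (\<Sum>i\<le>Suc l. smult (c i) (b i)) (Suc l) = c (Suc l) * coeff (b (Suc l)) (Suc l)"
    by (simp add: coeff_sum coeff_eq_0 assms(1))
  moreover have "coeff (b (Suc l)) (Suc l) \<noteq> 0"
    using assms(1,2)[of "Suc l"] by (metis leading_coeff_0_iff)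
  ultimately have "c (Suc l) = 0" unfolding Suc.prems coeff_0 by simp
  then show ?case using Suc by (auto simp: le_Suc_eq)
qed

lemma C_SstarE:
  assumes "a \<in> C_Sstar"
  obtains S c where "finite S" "0 \<notin> S" "\<And>k. a k = (\<Sum>\<mu>\<in>S. c \<mu> * \<mu> ^ k)"
proof -
  from assms obtain t r where t: "finite t" "t \<subseteq> Sstar" "a = (\<Sum>s\<in>t. seq_scale (r s) s)"
    unfolding C_Sstar_def seq.span_explicit by auto
  have eval: "(\<Sum>s\<in>t. f s) k = (\<Sum>s\<in>t. f s k)" for f :: "_ \<Rightarrow> nat \<Rightarrow> complex" and k
    using t(1) by (induction t rule: finite_induct) auto
  have s1: "s 1 \<noteq> 0 \<and> s = geom_seq (s 1)" if "s \<in> t" for s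
    using that t(2) by (auto simp: Sstar_def geom_seq_def)
  have inj: "inj_on (\<lambda>s. s 1) t"
  proof (rule inj_onI)
    fix x y assume "x \<in> t" "y \<in> t" "x 1 = y 1"
    then show "x = y" using s1[of x] s1[of y] by argo
  qed
  show ?thesis
  proof (rule that[of "(\<lambda>s. s 1) ` t" "\<lambda>\<mu>. r (geom_seq \<mu>)"])
    fix k
    have "r s * s k = r (geom_seq (s 1)) * s 1 ^ k" if "s \<in> t" for s
    proof -
      have "s k = s 1 ^ k" using s1[OF that] by (metis geom_seq_def)
      then show ?thesis using s1[OF that] by argo
    qed
    then show "a k = (\<Sum>\<mu>\<in>(\<lambda>s. s 1) ` t. r (geom_seq \<mu>) * \<mu> ^ k)"
      unfolding t(3) eval sum.reindex[OF inj] o_def seq_scale_def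
      by (intro sum.cong refl)
  next
    show "finite ((\<lambda>s. s 1) ` t)" using t(1) by simp
    show "0 \<notin> (\<lambda>s. s 1) ` t" using s1 by fastforce
  qed
qed

lemma scalar_form_eq_0:
  fixes b :: "nat \<Rightarrow> complex poly"
  assumes b: "\<And>i. degree (b i) = i" "\<And>i. b i \<noteq> 0" "\<And>i k. B i k = poly (b i) (of_nat k)"
    and a: "\<And>i. i \<le> l \<Longrightarrow> a i \<in> C_Sstar"
    and eq: "\<And>k. (\<Sum>i\<le>n. zero_seq i k * v i) + (\<Sum>i\<le>l. B i k * a i k) = 0"
  shows "\<forall>i\<le>l. a i = 0" "\<forall>i\<le>n. v i = 0"
proof -
  have "\<exists>S c. finite S \<and> 0 \<notin> S \<and> (\<forall>k. a i k = (\<Sum>\<mu>\<in>S. c \<mu> * \<mu> ^ k))" if "i \<le> l" for i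
    using C_SstarE[OF a[OF that]] by metis
  then obtain S c where Sc: "\<And>i. i \<le> l \<Longrightarrow> finite (S i)" "\<And>i. i \<le> l \<Longrightarrow> 0 \<notin> S i"
    "\<And>i k. i \<le> l \<Longrightarrow> a i k = (\<Sum>\<mu>\<in>S i. c i \<mu> * \<mu> ^ k)"
    by metis
  define U where "U = (\<Union>i\<le>l. S i)"
  define d where "d i \<mu> = (if \<mu> \<in> S i then c i \<mu> else 0)" for i \<mu>
  have U: "finite U" "0 \<notin> U" using Sc by (auto simp: U_def)
  have aU: "a i k = (\<Sum>\<mu>\<in>U. d i \<mu> * \<mu> ^ k)" if "i \<le> l" for i k
    unfolding Sc(3)[OF that]
    by (rule sum.mono_neutral_cong_left) (use U that in \<open>auto simp: U_def d_def\<close>)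
  define p where "p \<mu> = (\<Sum>i\<le>l. smult (d i \<mu>) (b i))" for \<mu>
  have "\<forall>\<mu>\<in>U. p \<mu> = 0"
  proof (rule exp_poly_eq_0[OF U, of "Suc n"])
    fix k assume k: "Suc n \<le> k"
    have "(\<Sum>i\<le>n. zero_seq i k * v i) = 0"
      using k by (intro sum.neutral) (auto simp: zero_seq_def)
    then have "0 = (\<Sum>i\<le>l. B i k * a i k)" using eq[of k] by simp
    also have "\<dots> = (\<Sum>i\<le>l. \<Sum>\<mu>\<in>U. poly (b i) (of_nat k) * (d i \<mu> * \<mu> ^ k))"
      by (intro sum.cong refl) (simp add: aU b(3) sum_distrib_left)
    also have "\<dots> = (\<Sum>\<mu>\<in>U. \<Sum>i\<le>l. poly (b i) (of_nat k) * (d i \<mu> * \<mu> ^ k))"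
      by (rule sum.swap)
    also have "\<dots> = (\<Sum>\<mu>\<in>U. poly (p \<mu>) (of_nat k) * \<mu> ^ k)"
      by (intro sum.cong refl) (simp add: p_def poly_sum sum_distrib_left sum_distrib_right algebra_simps)
    finally show "(\<Sum>\<mu>\<in>U. poly (p \<mu>) (of_nat k) * \<mu> ^ k) = 0" by simp
  qed
  then have "d i \<mu> = 0" if "i \<le> l" "\<mu> \<in> U" for i \<mu>
    using graded_poly_independent[OF b(1,2), of "\<lambda>i. d i \<mu>" l] that by (auto simp: p_def)
  then show a0: "\<forall>i\<le>l. a i = 0"
    by (auto simp: fun_eq_iff aU)
  show "\<forall>i\<le>n. v i = 0"
  proof (intro allI impI)
    fix i assume "i \<le> n"
    have "(\<Sum>j\<le>n. zero_seq j i * v j) = 0" using eq[of i] a0 by simp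
    moreover have "(\<Sum>j\<le>n. zero_seq j i * v j) = (\<Sum>j\<le>n. if j = i then v i else 0)"
      by (intro sum.cong) (auto simp: zero_seq_def)
    ultimately show "v i = 0" using \<open>i \<le> n\<close> by simp
  qed
qed

lemma P_canonical_form_unique:
  fixes b :: "nat \<Rightarrow> complex poly"
  assumes b: "\<And>i. degree (b i) = i" "\<And>i. b i \<noteq> 0" "\<And>i k. B i k = poly (b i) (of_nat k)"
    and P: "P_canonical_form B M n V l \<A>" "P_canonical_form B M n' V' l' \<A>'"
  shows "(if i \<le> n then V i else 0) = (if i \<le> n' then V' i else 0)"
    and "(if i \<le> l then \<A> i k else 0) = (if i \<le> l' then \<A>' i k else 0)"
proof -
  define W where "W i = (if i \<le> n then V i else 0) - (if i \<le> n' then V' i else 0)" for i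
  define \<C> where "\<C> i k = (if i \<le> l then \<A> i k else 0) - (if i \<le> l' then \<A>' i k else 0)" for i k
  have ext: "(\<Sum>i\<le>m. f i * x i) = (\<Sum>i\<le>max m m'. f i * (if i \<le> m then x i else 0))"
    for f x :: "nat \<Rightarrow> complex" and m m'
    by (rule sum.mono_neutral_cong_left) auto
  have 0: "(\<forall>i\<le>max l l'. (\<lambda>k. \<C> i k $ r $ c) = 0) \<and> (\<forall>i\<le>max n n'. W i $ r $ c = 0)" for r c
  proof (intro conjI; rule scalar_form_eq_0[OF b])
    show "(\<lambda>k. \<C> i k $ r $ c) \<in> C_Sstar" for i
    proof -
      have "(\<lambda>k. (if i \<le> l then \<A> i k else 0) $ r $ c) \<in> C_Sstar"
        using P(1) seq.span_zero[of Sstar]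
        by (cases "i \<le> l") (auto simp: P_canonical_form_def C_Sstar_def zero_fun_def)
      moreover have "(\<lambda>k. (if i \<le> l' then \<A>' i k else 0) $ r $ c) \<in> C_Sstar"
        using P(2) seq.span_zero[of Sstar]
        by (cases "i \<le> l'") (auto simp: P_canonical_form_def C_Sstar_def zero_fun_def)
      ultimately have "(\<lambda>k. (if i \<le> l then \<A> i k else 0) $ r $ c)
          - (\<lambda>k. (if i \<le> l' then \<A>' i k else 0) $ r $ c) \<in> C_Sstar"
        unfolding C_Sstar_def by (rule seq.span_diff)
      then show ?thesis by (simp add: \<C>_def fun_diff_def)
    qed
    then show "(\<lambda>k. \<C> i k $ r $ c) \<in> C_Sstar" for i .
    have e: "mat_power M k $ r $ c =
        (\<Sum>i\<le>n. zero_seq i k * V i $ r $ c) + (\<Sum>i\<le>l. B i k * \<A> i k $ r $ c)"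
      "mat_power M k $ r $ c =
        (\<Sum>i\<le>n'. zero_seq i k * V' i $ r $ c) + (\<Sum>i\<le>l'. B i k * \<A>' i k $ r $ c)" for k
    proof -
      have *: "mat_power M k = (\<Sum>i\<le>n. zero_seq i k *\<^sub>m V i) + (\<Sum>i\<le>l. B i k *\<^sub>m \<A> i k)"
        using P(1) unfolding P_canonical_form_def by blast
      show "mat_power M k $ r $ c =
          (\<Sum>i\<le>n. zero_seq i k * V i $ r $ c) + (\<Sum>i\<le>l. B i k * \<A> i k $ r $ c)"
        unfolding * by (simp add: mat_scale_def)
      have *: "mat_power M k = (\<Sum>i\<le>n'. zero_seq i k *\<^sub>m V' i) + (\<Sum>i\<le>l'. B i k *\<^sub>m \<A>' i k)"
        using P(2) unfolding P_canonical_form_def by blast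
      show "mat_power M k $ r $ c =
          (\<Sum>i\<le>n'. zero_seq i k * V' i $ r $ c) + (\<Sum>i\<le>l'. B i k * \<A>' i k $ r $ c)"
        unfolding * by (simp add: mat_scale_def)
    qed
    show "(\<Sum>i\<le>max n n'. zero_seq i k * W i $ r $ c)
        + (\<Sum>i\<le>max l l'. B i k * \<C> i k $ r $ c) = 0" for k
    proof -
      have "(\<Sum>i\<le>max n n'. zero_seq i k * W i $ r $ c)
          = (\<Sum>i\<le>n. zero_seq i k * V i $ r $ c) - (\<Sum>i\<le>n'. zero_seq i k * V' i $ r $ c)"
        unfolding ext[of _ _ n n'] ext[of _ _ n' n] max.commute[of n' n] sum_subtractf[symmetric]
        by (intro sum.cong) (auto simp: W_def algebra_simps)
      moreover have "(\<Sum>i\<le>max l l'. B i k * \<C> i k $ r $ c)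
          = (\<Sum>i\<le>l. B i k * \<A> i k $ r $ c) - (\<Sum>i\<le>l'. B i k * \<A>' i k $ r $ c)"
        unfolding ext[of _ _ l l'] ext[of _ _ l' l] max.commute[of l' l] sum_subtractf[symmetric]
        by (intro sum.cong) (auto simp: \<C>_def algebra_simps)
      moreover have "x - x' + (y - y') = 0" if "z = x + y" "z = x' + y'" for x x' y y' z :: complex
        using that by (simp add: algebra_simps)
      ultimately show ?thesis using e[of k] by simp
    qed
    then show "(\<Sum>i\<le>max n n'. zero_seq i k * W i $ r $ c)
        + (\<Sum>i\<le>max l l'. B i k * \<C> i k $ r $ c) = 0" for k .
  qed
  have "W i = 0"
  proof (cases "i \<le> max n n'")
    case True
    then show ?thesis using 0 by (simp add: vec_eq_iff)
  qed (auto simp: W_def)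
  then show "(if i \<le> n then V i else 0) = (if i \<le> n' then V' i else 0)"
    by (simp only: W_def right_minus_eq)
  have "\<C> i k = 0"
  proof (cases "i \<le> max l l'")
    case True
    then show ?thesis using 0 by (simp add: vec_eq_iff fun_eq_iff)
  qed (auto simp: \<C>_def)
  then show "(if i \<le> l then \<A> i k else 0) = (if i \<le> l' then \<A>' i k else 0)"
    by (simp only: \<C>_def right_minus_eq)
qed

lemma P_canonical_form_H_unique:
  assumes "P_canonical_form_H M n V l \<A>" "P_canonical_form_H M n' V' l' \<A>'"
  shows "(if i \<le> n then V i else 0) = (if i \<le> n' then V' i else 0)"
    and "(if i \<le> l then \<A> i k else 0) = (if i \<le> l' then \<A>' i k else 0)"
proof -
  have B: "(Gamma_seq ^ i) k = poly (monom 1 i) (of_nat k)" for i k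
    by (induction i) (simp_all add: Gamma_seq_def poly_monom)
  note U = P_canonical_form_unique[of "monom 1", OF degree_monom_eq _ B
      assms[unfolded P_canonical_form_H_def]]
  show "(if i \<le> n then V i else 0) = (if i \<le> n' then V' i else 0)"
    and "(if i \<le> l then \<A> i k else 0) = (if i \<le> l' then \<A>' i k else 0)"
    by (rule U; simp)+
qed

lemma P_canonical_form_T_unique:
  assumes "P_canonical_form_T M n V l \<A>" "P_canonical_form_T M n' V' l' \<A>'"
  shows "(if i \<le> n then V i else 0) = (if i \<le> n' then V' i else 0)"
    and "(if i \<le> l then \<A> i k else 0) = (if i \<le> l' then \<A>' i k else 0)"
proof -
  define b :: "nat \<Rightarrow> complex poly"
    where "b i = smult (1 / fact i) (\<Prod>j<i. [:- of_nat j, 1:])" for i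
  have deg: "degree (b i) = i" for i
    by (simp add: b_def degree_prod_eq_sum_degree)
  have nz: "b i \<noteq> 0" for i
    by (simp add: b_def)
  have B: "Lambda_seq i k = poly (b i) (of_nat k)" for i k
    by (simp add: b_def Lambda_seq_def poly_prod binomial_gbinomial gbinomial_prod_rev
        atLeast0LessThan)
  note U = P_canonical_form_unique[OF deg nz B assms[unfolded P_canonical_form_T_def]]
  show "(if i \<le> n then V i else 0) = (if i \<le> n' then V' i else 0)"
    and "(if i \<le> l then \<A> i k else 0) = (if i \<le> l' then \<A>' i k else 0)"
    by (rule U)+
qed

end

theory Submission
  imports Defs
begin

text \<open>
  The \<open>k\<close>-th power of \<open>e\<^bsup>tA\<^esup>\<close> is \<open>e\<^bsup>ktA\<^esup>\<close>, so it suffices to compute \<open>e\<^bsup>sA\<^esup>\<close> for every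
  scalar \<open>s\<close> and to put \<open>s = kt\<close>. The canonical form of \<open>A\<close> lists the powers \<open>A\<^sup>j\<close>, and summing
  it against \<open>s\<^sup>j / j!\<close> over \<open>j\<close> treats the terms one at a time: the Kronecker sequence of index
  \<open>i\<close> contributes the single summand \<open>s\<^sup>i / i!\<close>, while \<open>\<mu>\<^sup>j (j choose i)\<close> contributes
  \<open>(s\<mu>)\<^sup>i e\<^bsup>s\<mu>\<^esup> / i!\<close>, because cancelling \<open>(j choose i)\<close> against \<open>j!\<close> leaves an exponential series
  shifted by \<open>i\<close> (\<open>binomial_exp_sums\<close>). This is \<open>mat_exp_of_canonical_form\<close>. At \<open>s = kt\<close> the
  factor \<open>s\<^sup>i\<close> becomes \<open>t\<^sup>i k\<^sup>i\<close> and \<open>e\<^bsup>s\<mu>\<^esup>\<close> becomes the \<open>k\<close>-th power of \<open>e\<^bsup>t\<mu>\<^esup>\<close>, which are the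
  substitutions asserted.

  The result is a canonical form because \<open>e\<^bsup>t\<mu>\<^esup>\<close> is never zero and a constant sequence is the
  geometric sequence of ratio \<open>1\<close>; so every coefficient lies in the span of the geometric
  sequences, and no Kronecker sequences remain, in accordance with \<open>e\<^bsup>tA\<^esup>\<close> being invertible.

  The identity for the powers of \<open>e\<^bsup>tA\<^esup>\<close> follows from \<open>e\<^bsup>sM\<^esup> e\<^bsup>tM\<^esup> = e\<^bsup>(s+t)M\<^esup>\<close>
  (\<open>mat_exp_mult\<close>), proved with the Cauchy product of complex series in each entry.
\<close>

section \<open>Matrix powers\<close>

lemma mat_scale_nth [simp]: "(c *\<^sub>m M) $ i $ j = c * M $ i $ j"
  by (simp add: mat_scale_def)

lemma matrix_mult_nth: "(M ** N) $ i $ j = (\<Sum>l\<in>UNIV. M $ i $ l * N $ l $ j)"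
  by (simp add: matrix_matrix_mult_def)

lemma mat_power_0 [simp]: "mat_power M 0 = mat 1"
  by (simp add: mat_power_def)

lemma mat_power_Suc [simp]: "mat_power M (Suc k) = M ** mat_power M k"
  by (simp add: mat_power_def)

lemma mat_power_add: "mat_power M (j + k) = mat_power M j ** mat_power M k"
  by (induction j) (simp_all add: matrix_mul_assoc)

lemma mat_power_mat_scale: "mat_power (c *\<^sub>m M) k = c ^ k *\<^sub>m mat_power M k"
  by (induction k) (simp_all add: vec_eq_iff matrix_mult_nth sum_distrib_left algebra_simps)

text \<open>
  The sum of the absolute values of all entries bounds every row sum, hence one multiplication
  by \<open>M\<close> enlarges the largest entry at most by this factor.
\<close>

lemma mat_power_entry_bound:
  fixes M :: "complex^'q^'q"
  obtains K where "\<And>k r c. norm (mat_power M k $ r $ c) \<le> K ^ k"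
proof -
  define a where "a = (\<Sum>r\<in>UNIV. \<Sum>c\<in>UNIV. norm (M $ r $ c))"
  have row: "(\<Sum>c\<in>UNIV. norm (M $ r $ c)) \<le> a" for r
    unfolding a_def by (rule member_le_sum) (auto intro: sum_nonneg)
  have "norm (mat_power M k $ r $ c) \<le> a ^ k" for k r c
  proof (induction k arbitrary: r)
    case 0
    show ?case by (simp add: mat_def)
  next
    case (Suc k)
    have "norm (mat_power M (Suc k) $ r $ c)
        \<le> (\<Sum>l\<in>UNIV. norm (M $ r $ l) * norm (mat_power M k $ l $ c))"
      by (simp add: matrix_mult_nth flip: norm_mult) (rule norm_sum)
    also have "\<dots> \<le> (\<Sum>l\<in>UNIV. norm (M $ r $ l)) * a ^ k"
      unfolding sum_distrib_right by (intro sum_mono mult_left_mono Suc) auto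
    also have "\<dots> \<le> a * a ^ k"
      using row by (intro mult_right_mono zero_le_power order_trans[OF _ row[of r]] sum_nonneg) auto
    finally show ?case by simp
  qed
  then show ?thesis by (rule that)
qed

section \<open>The matrix exponential\<close>

lemma exp_entries_abs_summable:
  "summable (\<lambda>k. norm (s ^ k / fact k * mat_power M k $ r $ c))"
proof -
  obtain K where K: "\<And>k r c. norm (mat_power M k $ r $ c) \<le> K ^ k"
    using mat_power_entry_bound[of M] by blast
  have "norm (s ^ k / fact k * mat_power M k $ r $ c) \<le> (norm s * K) ^ k /\<^sub>R fact k" for k
  proof -
    have "norm (s ^ k / fact k * mat_power M k $ r $ c)
        = norm s ^ k / fact k * norm (mat_power M k $ r $ c)"
      by (simp add: norm_mult norm_divide norm_power)
    also have "\<dots> \<le> norm s ^ k / fact k * K ^ k"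
      by (intro mult_left_mono K) auto
    finally show ?thesis by (simp add: power_mult_distrib field_simps)
  qed
  then show ?thesis
    by (intro summable_comparison_test[OF _ summable_exp_generic[of "norm s * K"]]) auto
qed

text \<open>
  Convergence in the space of matrices is convergence of all entries, so the exponential may be
  handled as a family of complex series.
\<close>

lemma mat_exp_entry_sums:
  "(\<lambda>k. s ^ k / fact k * mat_power M k $ r $ c) sums (mat_exp (s *\<^sub>m M) $ r $ c)"
proof -
  define L where "L = (\<chi> r c. \<Sum>k. s ^ k / fact k * mat_power M k $ r $ c)"
  have entry: "(\<lambda>k. s ^ k / fact k * mat_power M k $ r $ c) sums (L $ r $ c)" for r c
    using summable_sums[OF summable_norm_cancel[OF exp_entries_abs_summable]]
    by (simp add: L_def)
  have "(\<lambda>k. (1 / fact k) *\<^sub>R mat_power (s *\<^sub>m M) k) sums L"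
    unfolding sums_def
  proof (intro vec_tendstoI)
    fix r c
    have "(\<Sum>k<N. (1 / fact k) *\<^sub>R mat_power (s *\<^sub>m M) k) $ r $ c
        = (\<Sum>k<N. s ^ k / fact k * mat_power M k $ r $ c)" for N
      by (simp add: mat_power_mat_scale scaleR_conv_of_real[where 'a = complex])
    then show "(\<lambda>N. (\<Sum>k<N. (1 / fact k) *\<^sub>R mat_power (s *\<^sub>m M) k) $ r $ c)
        \<longlonglongrightarrow> L $ r $ c"
      using entry[of r c] by (simp add: sums_def)
  qed
  then have "mat_exp (s *\<^sub>m M) = L"
    unfolding mat_exp_def by (rule sums_unique[symmetric])
  then show ?thesis using entry by simp
qed

text \<open>
  All powers of \<open>M\<close> commute, so in the Cauchy product the coefficient of \<open>M\<^sup>k\<close> is the one given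
  by the binomial theorem for the scalars \<open>s\<close> and \<open>t\<close>.
\<close>

lemma mat_exp_mult: "mat_exp (s *\<^sub>m M) ** mat_exp (t *\<^sub>m M) = mat_exp ((s + t) *\<^sub>m M)"
proof -
  have "(mat_exp (s *\<^sub>m M) ** mat_exp (t *\<^sub>m M)) $ r $ c = mat_exp ((s + t) *\<^sub>m M) $ r $ c"
    for r c
  proof (rule sums_unique2)
    let ?a = "\<lambda>s r c k. s ^ k / fact k * mat_power M k $ r $ c"
    have "(\<lambda>k. \<Sum>i\<le>k. ?a s r l i * ?a t l c (k - i)) sums
        (mat_exp (s *\<^sub>m M) $ r $ l * mat_exp (t *\<^sub>m M) $ l $ c)" for l
      using Cauchy_product_sums[OF exp_entries_abs_summable exp_entries_abs_summable]
      by (simp add: sums_unique[OF mat_exp_entry_sums])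
    then have "(\<lambda>k. \<Sum>l\<in>UNIV. \<Sum>i\<le>k. ?a s r l i * ?a t l c (k - i)) sums
        (mat_exp (s *\<^sub>m M) ** mat_exp (t *\<^sub>m M)) $ r $ c"
      unfolding matrix_mult_nth by (rule sums_sum)
    moreover have "(\<Sum>l\<in>UNIV. \<Sum>i\<le>k. ?a s r l i * ?a t l c (k - i)) = ?a (s + t) r c k" for k
    proof -
      have "(\<Sum>l\<in>UNIV. \<Sum>i\<le>k. ?a s r l i * ?a t l c (k - i))
          = (\<Sum>i\<le>k. s ^ i / fact i * (t ^ (k - i) / fact (k - i))
              * (mat_power M i ** mat_power M (k - i)) $ r $ c)"
        by (subst sum.swap) (simp add: matrix_mult_nth sum_distrib_left mult_ac)
      also have "\<dots> = (\<Sum>i\<le>k. of_nat (k choose i) * s ^ i * t ^ (k - i) / fact k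
              * mat_power M k $ r $ c)"
      proof (intro sum.cong refl)
        fix i assume "i \<in> {..k}"
        then have i: "i \<le> k" by simp
        then have "mat_power M i ** mat_power M (k - i) = mat_power M k"
          by (simp flip: mat_power_add)
        then show "s ^ i / fact i * (t ^ (k - i) / fact (k - i))
              * (mat_power M i ** mat_power M (k - i)) $ r $ c
            = of_nat (k choose i) * s ^ i * t ^ (k - i) / fact k * mat_power M k $ r $ c"
          by (simp add: binomial_fact[OF i])
      qed
      also have "\<dots> = ?a (s + t) r c k"
        unfolding binomial_ring[of s t k] sum_divide_distrib sum_distrib_right ..
      finally show ?thesis .
    qed
    ultimately show "?a (s + t) r c sums (mat_exp (s *\<^sub>m M) ** mat_exp (t *\<^sub>m M)) $ r $ c"
      by simp
  qed (rule mat_exp_entry_sums)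
  then show ?thesis by (simp add: vec_eq_iff)
qed

lemma mat_exp_0: "mat_exp (0 *\<^sub>m M) = mat 1"
proof -
  have "mat_exp (0 *\<^sub>m M) $ r $ c = mat 1 $ r $ c" for r c
  proof (rule sums_unique2[OF mat_exp_entry_sums])
    show "(\<lambda>k. 0 ^ k / fact k * mat_power M k $ r $ c) sums mat 1 $ r $ c"
      using powser_sums_zero[of "\<lambda>k. mat_power M k $ r $ c / fact k"]
      by (simp add: mult.commute)
  qed
  then show ?thesis by (simp add: vec_eq_iff)
qed

lemma mat_power_mat_exp: "mat_power (mat_exp (t *\<^sub>m M)) k = mat_exp ((of_nat k * t) *\<^sub>m M)"
  by (induction k) (simp_all add: mat_exp_0 mat_exp_mult algebra_simps)

section \<open>Exponential sums of the canonical form\<close>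

text \<open>
  The terms with \<open>j < i\<close> vanish, and \<open>(j + i choose i) / (j + i)! = 1 / (i! j!)\<close>: after the shift
  by \<open>i\<close> the exponential series of \<open>x\<close> remains.
\<close>

lemma binomial_exp_sums:
  fixes x :: complex
  shows "(\<lambda>j. x ^ j / fact j * of_nat (j choose i)) sums (x ^ i / fact i * exp x)"
proof -
  let ?f = "\<lambda>j. x ^ j / fact j * of_nat (j choose i)"
  have "?f (j + i) = x ^ i / fact i * (x ^ j /\<^sub>R fact j)" for j
  proof -
    have "of_nat (j + i choose i) / fact (j + i) = (1 / (fact i * fact j) :: complex)"
      by (simp add: binomial_fact)
    then have "?f (j + i) = x ^ (j + i) * (1 / (fact i * fact j))"
      by (metis times_divide_eq_left times_divide_eq_right)
    then show ?thesis
      by (simp add: power_add scaleR_conv_of_real field_simps)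
  qed
  then have "(\<lambda>j. ?f (j + i)) sums (x ^ i / fact i * exp x)"
    using sums_mult[OF exp_converges[of x], of "x ^ i / fact i"] by simp
  moreover have "(\<Sum>j<i. ?f j) = 0"
    by (intro sum.neutral) (simp add: binomial_eq_0)
  ultimately show ?thesis
    using sums_iff_shift[of ?f i "x ^ i / fact i * exp x"] by (simp only: add_0_right)
qed

lemma zero_seq_exp_sums: "(\<lambda>j. s ^ j / fact j * zero_seq i j) sums (s ^ i / fact i)"
  using sums_single[of i "\<lambda>j. s ^ j / fact j :: complex"]
  by (auto simp: zero_seq_def if_distrib eq_commute[of i] cong: if_cong)

text \<open>
  In each entry the expansion of the powers is a finite combination of the sequences of the two
  preceding lemmas, with \<open>x = s\<mu>\<close>, so the exponential series may be summed term by term.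
  The scalar \<open>s\<close> is kept free because the \<open>k\<close>-th power of \<open>e\<^bsup>tA\<^esup>\<close> calls for \<open>s = kt\<close>.
\<close>

lemma mat_exp_of_canonical_form:
  assumes powers: "\<And>j. mat_power A j = (\<Sum>i\<le>n. zero_seq i j *\<^sub>m V i)
      + (\<Sum>i\<le>m. \<Sum>\<mu>\<in>S i. (Lambda_seq i j * geom_seq \<mu> j) *\<^sub>m C i \<mu>)"
  shows "mat_exp (s *\<^sub>m A) = (\<Sum>i\<le>n. (s ^ i / fact i) *\<^sub>m V i)
      + (\<Sum>i\<le>m. \<Sum>\<mu>\<in>S i. ((s * \<mu>) ^ i * exp (s * \<mu>) / fact i) *\<^sub>m C i \<mu>)"
    (is "_ = ?E")
proof -
  have "mat_exp (s *\<^sub>m A) $ r $ c = ?E $ r $ c" for r c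
  proof (rule sums_unique2[OF mat_exp_entry_sums])
    have "(\<lambda>j. (\<Sum>i\<le>n. s ^ j / fact j * zero_seq i j * V i $ r $ c)
        + (\<Sum>i\<le>m. \<Sum>\<mu>\<in>S i. (s * \<mu>) ^ j / fact j * of_nat (j choose i) * C i \<mu> $ r $ c))
        sums ((\<Sum>i\<le>n. s ^ i / fact i * V i $ r $ c)
        + (\<Sum>i\<le>m. \<Sum>\<mu>\<in>S i. (s * \<mu>) ^ i / fact i * exp (s * \<mu>) * C i \<mu> $ r $ c))"
      by (intro sums_add sums_sum sums_mult2 zero_seq_exp_sums binomial_exp_sums)
    moreover have "s ^ j / fact j * mat_power A j $ r $ c
        = (\<Sum>i\<le>n. s ^ j / fact j * zero_seq i j * V i $ r $ c)
        + (\<Sum>i\<le>m. \<Sum>\<mu>\<in>S i. (s * \<mu>) ^ j / fact j * of_nat (j choose i) * C i \<mu> $ r $ c)" for j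
      unfolding powers
      by (simp add: distrib_left sum_distrib_left Lambda_seq_def geom_seq_def
          power_mult_distrib mult_ac)
    ultimately show "(\<lambda>j. s ^ j / fact j * mat_power A j $ r $ c) sums ?E $ r $ c"
      by simp
  qed
  then show ?thesis by (simp add: vec_eq_iff)
qed

section \<open>Coefficients in the span of the geometric sequences\<close>

lemma geom_seq_scale_in_C_Sstar: "\<mu> \<noteq> 0 \<Longrightarrow> (\<lambda>k. geom_seq \<mu> k * c) \<in> C_Sstar"
  using seq.span_scale[OF seq.span_base, of "geom_seq \<mu>" Sstar c]
  by (auto simp: C_Sstar_def Sstar_def seq_scale_def mult.commute)

lemma const_in_C_Sstar: "(\<lambda>_. c) \<in> C_Sstar"
  using geom_seq_scale_in_C_Sstar[of 1 c] by (simp add: geom_seq_def)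

lemma C_Sstar_add: "a \<in> C_Sstar \<Longrightarrow> b \<in> C_Sstar \<Longrightarrow> (\<lambda>k. a k + b k) \<in> C_Sstar"
  unfolding C_Sstar_def using seq.span_add[of a Sstar b] by (simp add: plus_fun_def)

lemma C_Sstar_sum: "(\<And>x. x \<in> X \<Longrightarrow> f x \<in> C_Sstar) \<Longrightarrow> (\<lambda>k. \<Sum>x\<in>X. f x k) \<in> C_Sstar"
  by (induction X rule: infinite_finite_induct) (auto intro: C_Sstar_add const_in_C_Sstar)

section \<open>The canonical form of the exponential\<close>

theorem theorem3p1:
  fixes A :: "complex^'q^'q" and V :: "nat \<Rightarrow> complex^'q^'q"
    and \<A> :: "nat \<Rightarrow> nat \<Rightarrow> complex^'q^'q"
    and S :: "nat \<Rightarrow> complex set" and C :: "nat \<Rightarrow> complex \<Rightarrow> complex^'q^'q"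
    and n m :: nat and t :: complex
  assumes canonical: "P_canonical_form_T A n V m \<A>"
    and S: "\<And>i. i \<le> m \<Longrightarrow> finite (S i)" "\<And>i. i \<le> m \<Longrightarrow> 0 \<notin> S i"
    and decomp: "\<And>i k. i \<le> m \<Longrightarrow> \<A> i k = (\<Sum>\<mu>\<in>S i. geom_seq \<mu> k *\<^sub>m C i \<mu>)"
  shows "P_canonical_form_H (mat_exp (t *\<^sub>m A)) 0 (\<lambda>_. 0) (max n m)
      (\<lambda>i k. (if i \<le> n then (t ^ i / fact i) *\<^sub>m V i else 0)
           + (if i \<le> m
              then \<Sum>\<mu>\<in>S i. ((t * \<mu>) ^ i * geom_seq (exp (t * \<mu>)) k / fact i) *\<^sub>m C i \<mu>
              else 0))
    \<and> (\<forall>k. mat_power (mat_exp (t *\<^sub>m A)) k =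
      (\<Sum>i\<le>n. (t ^ i * (Gamma_seq ^ i) k / fact i) *\<^sub>m V i)
      + (\<Sum>i\<le>m. \<Sum>\<mu>\<in>S i.
          ((t * \<mu>) ^ i * geom_seq (exp (t * \<mu>)) k * (Gamma_seq ^ i) k / fact i) *\<^sub>m C i \<mu>))"
proof -
  let ?N = "\<lambda>i. if i \<le> n then (t ^ i / fact i) *\<^sub>m V i else 0"
  let ?G = "\<lambda>i k. if i \<le> m
    then \<Sum>\<mu>\<in>S i. ((t * \<mu>) ^ i * geom_seq (exp (t * \<mu>)) k / fact i) *\<^sub>m C i \<mu> else 0"
  have Gamma: "(Gamma_seq ^ i) k = of_nat k ^ i" for i k
    by (induction i) (simp_all add: Gamma_seq_def)
  have "mat_power A j = (\<Sum>i\<le>n. zero_seq i j *\<^sub>m V i)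
      + (\<Sum>i\<le>m. \<Sum>\<mu>\<in>S i. (Lambda_seq i j * geom_seq \<mu> j) *\<^sub>m C i \<mu>)" for j
  proof -
    have "Lambda_seq i j *\<^sub>m \<A> i j = (\<Sum>\<mu>\<in>S i. (Lambda_seq i j * geom_seq \<mu> j) *\<^sub>m C i \<mu>)"
      if "i \<le> m" for i
      by (simp add: decomp[OF that] vec_eq_iff sum_distrib_left mult.assoc)
    then show ?thesis
      using canonical by (simp add: P_canonical_form_T_def P_canonical_form_def)
  qed
  note exp_form = mat_exp_of_canonical_form[OF this]
  have powers: "mat_power (mat_exp (t *\<^sub>m A)) k =
      (\<Sum>i\<le>n. (t ^ i * (Gamma_seq ^ i) k / fact i) *\<^sub>m V i)
      + (\<Sum>i\<le>m. \<Sum>\<mu>\<in>S i.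
          ((t * \<mu>) ^ i * geom_seq (exp (t * \<mu>)) k * (Gamma_seq ^ i) k / fact i) *\<^sub>m C i \<mu>)" for k
  proof -
    have "exp (of_nat k * t * \<mu>) = exp (t * \<mu>) ^ k" for \<mu>
      by (simp add: mult.assoc exp_of_nat_mult)
    then show ?thesis
      unfolding mat_power_mat_exp
      by (simp add: exp_form Gamma geom_seq_def power_mult_distrib mult_ac)
  qed
  \<comment> \<open>The Kronecker and the geometric part of \<open>A\<close> now both carry \<open>\<Gamma>\<^sup>i\<close>; padded with zeros up to
     the common length, they merge into one coefficient of \<open>\<Gamma>\<^sup>i\<close>.\<close>
  have "mat_power (mat_exp (t *\<^sub>m A)) k
      = (\<Sum>i\<le>0. zero_seq i k *\<^sub>m 0) + (\<Sum>i\<le>max n m. (Gamma_seq ^ i) k *\<^sub>m (?N i + ?G i k))" for k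
  proof -
    have "(\<Sum>i\<le>n. (t ^ i * (Gamma_seq ^ i) k / fact i) *\<^sub>m V i)
        = (\<Sum>i\<le>max n m. (Gamma_seq ^ i) k *\<^sub>m ?N i)"
      by (rule sum.mono_neutral_cong_left) (auto simp: vec_eq_iff mult_ac)
    moreover have "(\<Sum>i\<le>m. \<Sum>\<mu>\<in>S i.
          ((t * \<mu>) ^ i * geom_seq (exp (t * \<mu>)) k * (Gamma_seq ^ i) k / fact i) *\<^sub>m C i \<mu>)
        = (\<Sum>i\<le>max n m. (Gamma_seq ^ i) k *\<^sub>m ?G i k)"
      by (rule sum.mono_neutral_cong_left) (auto simp: vec_eq_iff sum_distrib_left mult_ac)
    moreover have "x *\<^sub>m (M + N) = x *\<^sub>m M + x *\<^sub>m N" for x and M N :: "complex^'q^'q"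
      by (simp add: vec_eq_iff distrib_left)
    moreover have "x *\<^sub>m 0 = (0 :: complex^'q^'q)" for x
      by (simp add: vec_eq_iff)
    ultimately show ?thesis
      unfolding powers by (simp only: sum.distrib) simp
  qed
  moreover have "(\<lambda>k. (?N i + ?G i k) $ r $ c) \<in> C_Sstar" for i r c
  proof -
    have "(\<lambda>k. \<Sum>\<mu>\<in>S i. geom_seq (exp (t * \<mu>)) k * ((t * \<mu>) ^ i / fact i * C i \<mu> $ r $ c))
        \<in> C_Sstar"
      by (intro C_Sstar_sum geom_seq_scale_in_C_Sstar) simp
    then have "(\<lambda>k. ?G i k $ r $ c) \<in> C_Sstar"
      by (cases "i \<le> m") (simp_all add: const_in_C_Sstar mult_ac)
    then have "(\<lambda>k. ?N i $ r $ c + ?G i k $ r $ c) \<in> C_Sstar"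
      by (rule C_Sstar_add[OF const_in_C_Sstar])
    then show ?thesis by (simp only: vector_add_component)
  qed
  ultimately have "P_canonical_form_H (mat_exp (t *\<^sub>m A)) 0 (\<lambda>_. 0) (max n m) (\<lambda>i k. ?N i + ?G i k)"
    unfolding P_canonical_form_H_def P_canonical_form_def by blast
  then show ?thesis using powers by blast
qed

end
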